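(* Let $\sigma$ be a unimodular irreducible Pisot substitution and $\hat\sigma$ its reverse substitution. Let $\mathfrak{R}_\sigma$ and $\mathfrak{R}_{\hat\sigma}$ be the corresponding Rauzy fractals. Then $\mathfrak{R}_\sigma=-\mathfrak{R}_{\hat\sigma}$. Moreover, $\mathfrak{R}_\sigma\cap\mathfrak{R}_{\hat\sigma}$ is a symmetric set with respect to the origin (i.e. it is invariant under $x\mapsto -x$).
   Context: A substitution on $\mathcal{A}=\{1,\ldots,k\}$ is a map $\sigma:\mathcal{A}\to\mathcal{A}^*$ (finite words), extended by concatenation to finite words and to two-sided sequences, where for $u\in\mathcal{A}^{\mathbb{Z}}$ the word $\sigma(u_0)$ starts at position $0$ of $\sigma(u)$ and $\sigma(u_{-1})$ ends at position $-1$. A fixed point is $u$ with $\sigma(u)=u$. The reverse substitution $\hat\sigma$ is defined by letting $\hat\sigma(i)$ be $\sigma(i)$ read backwards: $[\hat\sigma(i)]_j=[\sigma(i)]_{|\sigma(i)|-j+1}$, where $[W]_j$ is the $j$-th symbol of $W$. The incidence matrix of $\sigma$ is $M=(m_{ij})_{1\le i,j\le k}$ with $m_{ij}$ the number of occurrences of $i$ in $\sigma(j)$; $\sigma$ and $\hat\sigma$ have the same incidence matrix. A Pisot number is a real algebraic integer greater than $1$ whose other Galois conjugates have modulus less than $1$. $\sigma$ is Pisot if the Perron-Frobenius eigenvalue $\lambda$ of $M$ is a Pisot number, irreducible Pisot if moreover the characteristic polynomial of $M$ is irreducible (over $\mathbb{Q}$), and unimodular if $|\det M|=1$. An irreducible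 Pisot substitution is primitive (some power of $M$ has all entries positive). Standing assumption: $\sigma$ has a fixed point in $\mathcal{A}^{\mathbb{Z}}$; a primitive substitution always has a periodic point, and $\sigma$ is replaced by a suitable power if necessary (the reverse of $\sigma^l$ is $\hat\sigma^l$). In the irreducible case $\mathbb{R}^k=E^u\oplus E^s$, where $E^u$ is the $\lambda$-eigenspace of $M$ and $E^s$ is the real $M$-invariant subspace corresponding to the Galois conjugates of $\lambda$ other than $\lambda$. Let $\pi:\mathbb{R}^k\to E^s$ be the projection onto $E^s$ along $E^u$. For a fixed point $u\in\mathcal{A}^{\mathbb{Z}}$, with $\{e_1,\ldots,e_k\}$ the canonical basis, let $$L_n=\sum_{i=0}^{n-1}e_{u_i}\ (n\ge 0),\qquad L_n=-\sum_{i=n}^{-1}e_{u_i}\ (n<0).$$ The Rauzy fractal of $\sigma$ is $\mathfrak{R}_\sigma=\overline{\{\pi(L_n): n\in\mathbb{Z}\}}\subset E^s$. It is known not to depend on the choice of the fixed (or periodic) point, and to equal $\overline{\{\pi(L_n): n\in\mathbb{N}\}}$. $\mathfrak{R}_{\hat\sigma}$ is defined in the same way from $\hat\sigma$ (with the same $\pi$). *)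

theory Defs
  imports "HOL-Analysis.Analysis" "HOL-Computational_Algebra.Computational_Algebra"
begin

section \<open>Substitutions\<close>

text \<open>
  The alphabet is a finite type \<open>'k\<close> (so \<open>k = CARD('k)\<close>), a substitution is a map
  \<open>'k \<Rightarrow> 'k list\<close>, and a two-sided sequence is a map \<open>int \<Rightarrow> 'k\<close>.
\<close>

definition reverse_subst :: "('k \<Rightarrow> 'k list) \<Rightarrow> 'k \<Rightarrow> 'k list" where
  "reverse_subst \<sigma> i = rev (\<sigma> i)"

text \<open>
  The word \<open>\<sigma>(u\<^sub>0) \<sigma>(u\<^sub>1) \<dots>\<close> is read to the right from position 0, and
  \<open>\<dots> \<sigma>(u\<^sub>-\<^sub>2) \<sigma>(u\<^sub>-\<^sub>1)\<close> to the left from position -1. For the symbol at position \<open>n\<close> it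
  is enough to apply \<open>\<sigma>\<close> between 0 and \<open>n\<close>, because no \<open>\<sigma> i\<close> is empty. For a
  substitution with an empty image the value may be unspecified; this cannot
  happen when the incidence matrix is invertible.
\<close>

definition subst_seq :: "('k \<Rightarrow> 'k list) \<Rightarrow> (int \<Rightarrow> 'k) \<Rightarrow> int \<Rightarrow> 'k" where
  "subst_seq \<sigma> u n =
     (if n \<ge> 0 then concat (map (\<lambda>i. \<sigma> (u i)) [0..n]) ! nat n
      else rev (concat (map (\<lambda>i. \<sigma> (u i)) [n..-1])) ! nat (- n - 1))"

definition fixed_point :: "('k \<Rightarrow> 'k list) \<Rightarrow> (int \<Rightarrow> 'k) \<Rightarrow> bool" where
  "fixed_point \<sigma> u \<longleftrightarrow> subst_seq \<sigma> u = u"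

definition incidence_matrix :: "('k \<Rightarrow> 'k list) \<Rightarrow> 'a::semiring_1 ^ 'k ^ 'k" where
  "incidence_matrix \<sigma> = (\<chi> i j. of_nat (count_list (\<sigma> j) i))"

lemma incidence_matrix_reverse: "incidence_matrix (reverse_subst \<sigma>) = incidence_matrix \<sigma>"
  by (simp add: incidence_matrix_def reverse_subst_def)


section \<open>Unimodular irreducible Pisot substitutions\<close>

definition charpoly :: "'a::comm_ring_1 ^ 'n ^ 'n \<Rightarrow> 'a poly" where
  "charpoly A = det (mat [:0, 1:] - (\<chi> i j. [:A $ i $ j:]))"

definition eigenvector :: "'a::field ^ 'n ^ 'n \<Rightarrow> 'a \<Rightarrow> 'a ^ 'n \<Rightarrow> bool" where
  "eigenvector A \<mu> v \<longleftrightarrow> v \<noteq> 0 \<and> A *v v = \<mu> *s v"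

definition eigenvalue :: "'a::field ^ 'n ^ 'n \<Rightarrow> 'a \<Rightarrow> bool" where
  "eigenvalue A \<mu> \<longleftrightarrow> (\<exists>v. eigenvector A \<mu> v)"

text \<open>
  The roots in \<open>\<complex>\<close> of the minimal polynomial of \<open>z\<close> over \<open>\<rat>\<close>, \<open>z\<close> itself included.
\<close>

definition galois_conjugates :: "complex \<Rightarrow> complex set" where
  "galois_conjugates z =
     {w. \<exists>p :: rat poly. irreducible p \<and> poly (map_poly of_rat p) z = 0 \<and>
                         poly (map_poly of_rat p) w = 0}"

definition pisot_number :: "real \<Rightarrow> bool" where
  "pisot_number x \<longleftrightarrow> algebraic_int x \<and> x > 1 \<and>
     (\<forall>w \<in> galois_conjugates (of_real x) - {of_real x}. cmod w < 1)"

text \<open>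
  The Perron-Frobenius eigenvalue of a nonnegative matrix is its spectral radius,
  which is itself an eigenvalue. There is at most one number as below.
\<close>

definition is_pf_eigenvalue :: "('k::finite \<Rightarrow> 'k list) \<Rightarrow> real \<Rightarrow> bool" where
  "is_pf_eigenvalue \<sigma> x \<longleftrightarrow>
     eigenvalue (incidence_matrix \<sigma> :: complex ^ 'k ^ 'k) (of_real x) \<and>
     (\<forall>\<mu>. eigenvalue (incidence_matrix \<sigma> :: complex ^ 'k ^ 'k) \<mu> \<longrightarrow> cmod \<mu> \<le> x)"

definition pf_eigenvalue :: "('k::finite \<Rightarrow> 'k list) \<Rightarrow> real" where
  "pf_eigenvalue \<sigma> = (THE x. is_pf_eigenvalue \<sigma> x)"

definition pisot_subst :: "('k::finite \<Rightarrow> 'k list) \<Rightarrow> bool" where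
  "pisot_subst \<sigma> \<longleftrightarrow> (\<exists>x. is_pf_eigenvalue \<sigma> x \<and> pisot_number x)"

definition irreducible_pisot_subst :: "('k::finite \<Rightarrow> 'k list) \<Rightarrow> bool" where
  "irreducible_pisot_subst \<sigma> \<longleftrightarrow>
     pisot_subst \<sigma> \<and> irreducible (charpoly (incidence_matrix \<sigma> :: rat ^ 'k ^ 'k))"

definition unimodular_subst :: "('k::finite \<Rightarrow> 'k list) \<Rightarrow> bool" where
  "unimodular_subst \<sigma> \<longleftrightarrow> \<bar>det (incidence_matrix \<sigma> :: int ^ 'k ^ 'k)\<bar> = 1"


section \<open>The Rauzy fractal\<close>

definition expanding_space :: "('k::finite \<Rightarrow> 'k list) \<Rightarrow> (real ^ 'k) set" where
  "expanding_space \<sigma> = {x. incidence_matrix \<sigma> *v x = pf_eigenvalue \<sigma> *s x}"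

text \<open>
  The real points of the sum of the complex eigenspaces for the Galois conjugates
  of the Perron-Frobenius eigenvalue other than itself. In the irreducible case all
  eigenvalues are simple, so no generalized eigenspaces are needed.
\<close>

definition contracting_space :: "('k::finite \<Rightarrow> 'k list) \<Rightarrow> (real ^ 'k) set" where
  "contracting_space \<sigma> =
     {x. (\<chi> i. complex_of_real (x $ i)) \<in>
           vec.span {v. \<exists>\<mu> \<in> galois_conjugates (of_real (pf_eigenvalue \<sigma>)) - {of_real (pf_eigenvalue \<sigma>)}.
                          eigenvector (incidence_matrix \<sigma>) \<mu> v}}"

text \<open>
  The projection onto the contracting space along the expanding space. It depends
  only on the incidence matrix, so it is the same for \<open>\<sigma>\<close> and its reverse.
\<close>

definition contracting_proj :: "('k::finite \<Rightarrow> 'k list) \<Rightarrow> real ^ 'k \<Rightarrow> real ^ 'k" where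
  "contracting_proj \<sigma> x = (THE y. y \<in> contracting_space \<sigma> \<and> x - y \<in> expanding_space \<sigma>)"

definition broken_line :: "(int \<Rightarrow> 'k::finite) \<Rightarrow> int \<Rightarrow> real ^ 'k" where
  "broken_line u n =
     (if n \<ge> 0 then \<Sum>i = 0..n - 1. axis (u i) 1 else - (\<Sum>i = n..-1. axis (u i) 1))"

text \<open>
  The Rauzy fractal is the common value, over all fixed points \<open>u\<close> of \<open>\<sigma>\<close>, of the
  closure of the projected vertices. That this set does not depend on \<open>u\<close> when \<open>\<sigma>\<close>
  is a unimodular irreducible Pisot substitution is what makes the definite description
  meaningful.
\<close>

definition rauzy_fractal :: "('k::finite \<Rightarrow> 'k list) \<Rightarrow> (real ^ 'k) set" where
  "rauzy_fractal \<sigma> =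
     (THE R. \<exists>u. fixed_point \<sigma> u \<and>
                 R = closure (range (\<lambda>n. contracting_proj \<sigma> (broken_line u n))))"

end

theory Submission
  imports Defs "HOL-Computational_Algebra.Field_as_Ring"
begin

text \<open>
  If \<open>u\<close> is a fixed point of \<open>\<sigma>\<close>, then the reflected sequence \<open>n \<mapsto> u (-1 - n)\<close> is a fixed point
  of the reverse substitution, and its broken line is the negative of that of \<open>u\<close>. What needs
  work is that the fractal does not depend on the fixed point. Write \<open>M\<close> for the incidence
  matrix and \<open>\<pi>\<close> for the projection, so that \<open>M\<^sup>n \<pi> x \<rightarrow> 0\<close>. Every letter \<open>b\<close> occurs in an image
  \<open>\<sigma>\<^sup>N(v\<^sub>0) = X b Y\<close> of the initial letter of a second fixed point \<open>v\<close>, so a prefix \<open>P\<close> of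
  \<open>\<sigma>\<^sup>n(b)\<close> yields the prefix \<open>\<sigma>\<^sup>n(X) P\<close> of \<open>v\<close>, whose vertex differs from that of \<open>P\<close> by
  \<open>M\<^sup>n\<close> applied to a fixed vector. Taking \<open>b = u\<^sub>0\<close> and \<open>P\<close> a fixed prefix of \<open>u\<close> treats the
  vertices of \<open>u\<close> with nonnegative index; taking \<open>b = u\<^sub>-\<^sub>1\<close> and \<open>\<sigma>\<^sup>n(b) = P S\<close> with \<open>S\<close> a fixed
  suffix treats the others, as the vertex of \<open>P\<close> is \<open>M\<^sup>n e\<^sub>b\<close> minus that of \<open>S\<close>.

  That every letter is reached from every other one follows without Perron-Frobenius theory
  from the spectral decomposition and the integrality of \<open>M\<close>.
\<close>

unbundle no fps_syntax

section \<open>Eigenvectors and irreducible characteristic polynomials\<close>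

lemma map_poly_of_rat_add:
  "map_poly of_rat (p + q) = (map_poly of_rat p + map_poly of_rat q :: 'a::field_char_0 poly)"
  by (rule poly_eqI) (simp add: coeff_map_poly of_rat_add)

lemma map_poly_of_rat_mult:
  "map_poly of_rat (p * q) = (map_poly of_rat p * map_poly of_rat q :: 'a::field_char_0 poly)"
  by (rule poly_eqI) (simp add: coeff_map_poly coeff_mult of_rat_sum of_rat_mult)

lemma map_poly_of_rat_sum:
  "map_poly of_rat (sum f A) = (\<Sum>x\<in>A. map_poly of_rat (f x) :: 'a::field_char_0 poly)"
  by (induction A rule: infinite_finite_induct) (auto simp: map_poly_of_rat_add)

lemma map_poly_of_rat_prod:
  "map_poly of_rat (prod f A) = (\<Prod>x\<in>A. map_poly of_rat (f x) :: 'a::field_char_0 poly)"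
  by (induction A rule: infinite_finite_induct) (auto simp: map_poly_of_rat_mult)

lemma map_poly_of_rat_pderiv:
  "map_poly of_rat (pderiv p) = (pderiv (map_poly of_rat p) :: 'a::field_char_0 poly)"
  by (rule poly_eqI) (simp add: coeff_map_poly coeff_pderiv of_rat_mult of_rat_add)

lemma map_poly_of_rat_det:
  fixes A :: "rat poly ^ 'n ^ 'n"
  shows "map_poly of_rat (det A)
       = (det (\<chi> i j. map_poly of_rat (A $ i $ j)) :: 'a::field_char_0 poly)"
proof -
  have *: "map_poly of_rat (of_int m :: rat poly) = (of_int m :: 'a poly)" for m
    by (rule poly_eqI) (simp add: coeff_map_poly of_int_poly coeff_pCons split: nat.split)
  show ?thesis
    unfolding det_def by (simp add: map_poly_of_rat_sum map_poly_of_rat_mult map_poly_of_rat_prod *)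
qed

lemma poly_det:
  fixes A :: "'a::comm_ring_1 poly ^ 'n ^ 'n"
  shows "poly (det A) x = det (\<chi> i j. poly (A $ i $ j) x)"
  unfolding det_def by (simp add: poly_sum poly_prod)

lemma poly_charpoly:
  fixes A :: "'a::comm_ring_1 ^ 'n ^ 'n"
  shows "poly (charpoly A) x = det (mat x - A)"
  unfolding charpoly_def poly_det
  by (rule arg_cong[where f = det]) (simp add: vec_eq_iff mat_def)

lemma map_poly_of_rat_charpoly_incidence:
  "map_poly of_rat (charpoly (incidence_matrix \<sigma> :: rat ^ 'k ^ 'k))
    = (charpoly (incidence_matrix \<sigma> :: complex ^ 'k ^ 'k))"
  unfolding charpoly_def map_poly_of_rat_det
  by (rule arg_cong[where f = det])
     (auto simp: vec_eq_iff mat_def incidence_matrix_def map_poly_pCons one_pCons of_rat_minus)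

text \<open>In the Leibniz expansion the identity permutation gives a product of monic linear
  factors. Every other permutation uses an off-diagonal entry, which is constant, and so contributes
  lower degree.\<close>

lemma degree_charpoly:
  fixes A :: "'a::field_char_0 ^ 'n ^ 'n"
  shows "degree (charpoly A) = CARD('n)"
proof -
  define B :: "'a poly ^ 'n ^ 'n" where "B = mat [:0, 1:] - (\<chi> i j. [:A $ i $ j:])"
  have diag: "B $ i $ i = [:- A $ i $ i, 1:]" for i
    by (simp add: B_def mat_def)
  have off: "degree (B $ i $ j) = 0" if "i \<noteq> j" for i j
    using that by (simp add: B_def mat_def)
  let ?P = "{p. p permutes (UNIV :: 'n set)}"
  let ?t = "\<lambda>p. of_int (sign p) * (\<Prod>i\<in>UNIV. B $ i $ p i)"
  have "det B = ?t id + (\<Sum>p\<in>?P - {id}. ?t p)"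
    unfolding det_def by (rule sum.remove) (auto simp: permutes_id finite_permutations)
  moreover have "?t id = (\<Prod>i\<in>UNIV. [:- A $ i $ i, 1:])"
    by (simp add: diag sign_id)
  moreover have "degree (\<Prod>i\<in>(UNIV::'n set). [:- A $ i $ i, 1:]) = CARD('n)"
    by (subst degree_prod_sum_eq) auto
  moreover have "degree (\<Sum>p\<in>?P - {id}. ?t p) < CARD('n)"
  proof (rule degree_sum_less)
    fix p assume "p \<in> ?P - {id}"
    then obtain i where i: "p i \<noteq> i" by (auto simp: fun_eq_iff)
    have "degree (\<Prod>i\<in>UNIV. B $ i $ p i) \<le> (\<Sum>i\<in>UNIV. degree (B $ i $ p i))"
      using degree_prod_sum_le[of UNIV "\<lambda>i. B $ i $ p i"] by (simp add: o_def)
    also have "\<dots> < (\<Sum>i\<in>(UNIV::'n set). 1)"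
    proof (rule sum_strict_mono_ex1)
      show "\<forall>x\<in>UNIV. degree (B $ x $ p x) \<le> 1"
        by (metis diag off degree_pCons_le degree_pCons_0 degree_1 One_nat_def le_numeral_extra(1) zero_le)
      show "\<exists>a\<in>UNIV. degree (B $ a $ p a) < 1"
        using i off[of i "p i"] by (intro bexI[of _ i]) auto
    qed simp
    finally have "degree (\<Prod>i\<in>UNIV. B $ i $ p i) < CARD('n)" by simp
    moreover have "degree (?t p) \<le> degree (\<Prod>i\<in>UNIV. B $ i $ p i)"
      by (metis add_0 degree_mult_le degree_of_int)
    ultimately show "degree (?t p) < CARD('n)" by linarith
  qed (simp add: card_gt_0_iff)
  ultimately show ?thesis
    unfolding charpoly_def B_def[symmetric] by (simp add: degree_add_eq_left)
qed

section \<open>Separability in characteristic zero\<close>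

lemma irreducible_rat_poly_coprime_pderiv:
  fixes p :: "rat poly"
  assumes "irreducible p"
  shows "coprime p (pderiv p)"
proof -
  have deg: "degree p \<noteq> 0"
    using assms by (metis irreducible_def is_unit_iff_degree)
  then have nz: "pderiv p \<noteq> 0" by (simp add: pderiv_eq_0_iff)
  have "\<not> p dvd pderiv p"
    using dvd_imp_degree_le[of p "pderiv p"] nz deg by (simp add: degree_pderiv)
  then show ?thesis
    using assms by (intro prime_elem_imp_coprime irreducible_imp_prime_elem)
qed

text \<open>A Bezout identity for \<open>p\<close> and \<open>pderiv p\<close> over the rationals
  survives base change; evaluated at a common root it would give 0 = 1.\<close>

lemma irreducible_rat_poly_rsquarefree:
  fixes p :: "rat poly"
  assumes "irreducible p"
  shows "rsquarefree (map_poly of_rat p :: 'a::field_char_0 poly)"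
  unfolding rsquarefree_roots
proof (intro allI notI)
  fix a :: 'a
  assume a: "poly (map_poly of_rat p) a = 0 \<and> poly (pderiv (map_poly of_rat p)) a = 0"
  obtain r s where "r * p + s * pderiv p = 1"
    using bezout_coefficients_fst_snd[of p "pderiv p"] irreducible_rat_poly_coprime_pderiv[OF assms]
    by (metis coprime_imp_gcd_eq_1)
  then have "map_poly of_rat (r * p + s * pderiv p) = (map_poly of_rat 1 :: 'a poly)" by simp
  then have "poly (map_poly of_rat r * map_poly of_rat p
      + map_poly of_rat s * pderiv (map_poly of_rat p)) a = 1"
    by (simp add: map_poly_of_rat_add map_poly_of_rat_mult map_poly_of_rat_pderiv)
  with a show False by simp
qed

lemma card_roots_rsquarefree:
  fixes p :: "complex poly"
  assumes "rsquarefree p"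
  shows "card {z. poly p z = 0} = degree p"
proof -
  have "p \<noteq> 0" using assms by (simp add: rsquarefree_def)
  then have "degree p = degree (smult (lead_coeff p) (\<Prod>z|poly p z = 0. [:-z, 1:]))"
    using complex_poly_decompose_rsquarefree[OF assms] by simp
  also have "\<dots> = (\<Sum>z|poly p z = 0. 1)"
    using \<open>p \<noteq> 0\<close> by (simp add: degree_prod_sum_eq)
  finally show ?thesis by simp
qed

section \<open>Eigenvectors for distinct eigenvalues\<close>

lemma eigenvalue_iff_charpoly:
  fixes A :: "'a::field ^ 'n ^ 'n"
  shows "eigenvalue A \<mu> \<longleftrightarrow> poly (charpoly A) \<mu> = 0"
proof -
  have mv: "(mat \<mu> - A) *v v = \<mu> *s v - A *v v" for v
    by (simp add: matrix_vector_mult_diff_rdistrib vec_eq_iff matrix_vector_mult_def mat_def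
        sum_subtractf left_diff_distrib if_distrib[where f = "\<lambda>x. x * _"] cong: if_cong)
  have "det (mat \<mu> - A) \<noteq> 0 \<longleftrightarrow> (\<forall>v. (mat \<mu> - A) *v v = 0 \<longrightarrow> v = 0)"
    unfolding invertible_det_nz[symmetric] invertible_left_inverse matrix_left_invertible_ker ..
  also have "\<dots> \<longleftrightarrow> \<not> eigenvalue A \<mu>"
    unfolding mv eigenvalue_def eigenvector_def by auto
  finally show ?thesis unfolding poly_charpoly by blast
qed

lemma eigenvectors_sum_zero:
  fixes A :: "'a::field ^ 'n ^ 'n"
  assumes "finite S" "\<And>\<mu>. \<mu> \<in> S \<Longrightarrow> A *v v \<mu> = \<mu> *s v \<mu>" "(\<Sum>\<mu>\<in>S. v \<mu>) = 0" "\<mu> \<in> S"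
  shows "v \<mu> = 0"
  using assms
proof (induction S arbitrary: v \<mu> rule: finite_induct)
  case (insert \<nu> S)
  \<comment> \<open>Applying \<open>A - \<nu>\<close> to the relation removes the term at
    \<open>\<nu>\<close> and multiplies the others by the nonzero scalars
    \<open>\<mu> - \<nu>\<close>.\<close>
  define w where "w = (\<lambda>\<mu>. (\<mu> - \<nu>) *s v \<mu>)"
  have Aw: "A *v w \<mu> = \<mu> *s w \<mu>" if "\<mu> \<in> S" for \<mu>
    using insert.prems(1)[of \<mu>] that
    by (simp add: w_def vec.scale vec.diff vector_smult_assoc mult.commute)
  have "(\<Sum>\<mu>\<in>S. w \<mu>) = (\<Sum>\<mu>\<in>insert \<nu> S. \<mu> *s v \<mu> - \<nu> *s v \<mu>)"
    using insert.hyps by (simp add: w_def vector_ssub_ldistrib vec.scale_left_diff_distrib)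
  also have "\<dots> = (\<Sum>\<mu>\<in>insert \<nu> S. A *v v \<mu>) - \<nu> *s (\<Sum>\<mu>\<in>insert \<nu> S. v \<mu>)"
    using insert.prems(1) by (simp only: sum_subtractf vec.scale_sum_right cong: sum.cong)
  also have "\<dots> = A *v (\<Sum>\<mu>\<in>insert \<nu> S. v \<mu>) - \<nu> *s (\<Sum>\<mu>\<in>insert \<nu> S. v \<mu>)"
    by (simp only: vec.sum)
  also have "\<dots> = 0"
    by (simp only: insert.prems(2)) simp
  finally have sum_w: "(\<Sum>\<mu>\<in>S. w \<mu>) = 0" .
  have v0: "v \<mu> = 0" if "\<mu> \<in> S" for \<mu>
  proof -
    have "w \<mu> = 0" by (rule insert.IH[OF Aw sum_w that])
    moreover have "\<mu> \<noteq> \<nu>" using that insert.hyps by auto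
    ultimately show ?thesis by (simp add: w_def)
  qed
  then have "v \<nu> = 0" using insert.prems(2) insert.hyps by simp
  with v0 insert.prems(3) show ?case by auto
qed simp

lemma span_eigenvectors:
  fixes A :: "'a::field ^ 'n ^ 'n"
  assumes S: "finite S" "card S = CARD('n)" and ev: "\<And>\<mu>. \<mu> \<in> S \<Longrightarrow> eigenvector A \<mu> (v \<mu>)"
  shows "vec.span (v ` S) = UNIV"
proof -
  have Av: "A *v v \<mu> = \<mu> *s v \<mu>" and nz: "v \<mu> \<noteq> 0" if "\<mu> \<in> S" for \<mu>
    using ev[OF that] by (auto simp: eigenvector_def)
  have inj: "inj_on v S"
  proof (rule inj_onI)
    fix \<mu> \<nu> assume *: "\<mu> \<in> S" "\<nu> \<in> S" "v \<mu> = v \<nu>"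
    then have "(\<mu> - \<nu>) *s v \<mu> = 0"
      using Av[of \<mu>] Av[of \<nu>] by (auto simp: vec.scale_left_diff_distrib)
    then show "\<mu> = \<nu>" using nz[OF *(1)] by simp
  qed
  have "vec.independent (v ` S)"
    unfolding vec.independent_explicit_finite_subsets
  proof (intro allI impI ballI)
    fix T u x assume T: "T \<subseteq> v ` S" "finite T" "(\<Sum>x\<in>T. u x *s x) = 0" and x: "x \<in> T"
    then obtain R where R: "R \<subseteq> S" "T = v ` R" by (auto simp: subset_image_iff)
    have injR: "inj_on v R" using inj R(1) by (rule inj_on_subset)
    obtain \<mu> where \<mu>: "\<mu> \<in> R" "x = v \<mu>" using x R by auto
    have "u (v \<mu>) *s v \<mu> = 0"
    proof (rule eigenvectors_sum_zero)
      show "finite R" using S R by (blast intro: finite_subset)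
      show "(\<Sum>\<mu>\<in>R. u (v \<mu>) *s v \<mu>) = 0"
        using T(3) injR by (simp add: R(2) sum.reindex)
      show "A *v (u (v \<nu>) *s v \<nu>) = \<nu> *s (u (v \<nu>) *s v \<nu>)" if "\<nu> \<in> R" for \<nu>
        using Av[of \<nu>] that R(1) by (auto simp: vec.scale vector_smult_assoc mult.commute)
    qed (use \<mu> in auto)
    then show "u x = 0" using nz \<mu> R by auto
  qed
  then have "UNIV \<subseteq> vec.span (v ` S)"
    using S card_image[OF inj] by (intro vec.card_ge_dim_independent) (auto simp: vec_dim_card simp del: vec.dim_UNIV)
  then show ?thesis by auto
qed

lemma funpow_mult_vec_linear:
  fixes A :: "'a::field ^ 'n ^ 'n"
  shows "((*v) A ^^ n) (x + y) = ((*v) A ^^ n) x + ((*v) A ^^ n) y"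
    and "((*v) A ^^ n) (c *s x) = c *s ((*v) A ^^ n) x"
  by (induction n) (simp_all add: vec.add vec.scale)

lemma funpow_mult_vec_eigen:
  fixes A :: "'a::field ^ 'n ^ 'n"
  assumes "A *v x = \<mu> *s x"
  shows "((*v) A ^^ n) x = \<mu> ^ n *s x"
  by (induction n) (simp_all add: assms vec.scale vector_smult_assoc mult.commute)

section \<open>Complexification and conjugation\<close>

definition cvec :: "real ^ 'n \<Rightarrow> complex ^ 'n" where
  "cvec x = (\<chi> i. complex_of_real (x $ i))"

lemma cvec_nth [simp]: "cvec x $ i = complex_of_real (x $ i)"
  by (simp add: cvec_def)

lemma cvec_simps:
  "cvec (x + y) = cvec x + cvec y" "cvec (x - y) = cvec x - cvec y" "cvec (- x) = - cvec x"
  "cvec (c *s x) = complex_of_real c *s cvec x"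
  by (simp_all add: vec_eq_iff)

lemma cvec_mult_incidence:
  "cvec (incidence_matrix \<sigma> *v x) = incidence_matrix \<sigma> *v cvec x"
  by (simp add: vec_eq_iff matrix_vector_mult_def incidence_matrix_def)

lemma cvec_funpow_incidence:
  "cvec (((*v) (incidence_matrix \<sigma>) ^^ n) x) = ((*v) (incidence_matrix \<sigma>) ^^ n) (cvec x)"
  by (induction n) (simp_all add: cvec_mult_incidence)

definition conj_vec :: "complex ^ 'n \<Rightarrow> complex ^ 'n" where
  "conj_vec v = (\<chi> i. cnj (v $ i))"

lemma conj_vec_nth [simp]: "conj_vec v $ i = cnj (v $ i)"
  by (simp add: conj_vec_def)

lemma conj_vec_simps:
  "conj_vec 0 = 0" "conj_vec (x + y) = conj_vec x + conj_vec y"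
  "conj_vec (c *s x) = cnj c *s conj_vec x"
  by (simp_all add: vec_eq_iff)

lemma conj_vec_mult_incidence:
  "conj_vec (incidence_matrix \<sigma> *v x) = incidence_matrix \<sigma> *v conj_vec x"
  by (simp add: vec_eq_iff matrix_vector_mult_def incidence_matrix_def)

lemma eigenvector_conj:
  assumes "eigenvector (incidence_matrix \<sigma>) \<mu> v"
  shows "eigenvector (incidence_matrix \<sigma>) (cnj \<mu>) (conj_vec v)"
  using assms unfolding eigenvector_def
  by (metis conj_vec_mult_incidence conj_vec_simps(3) conj_vec_nth complex_cnj_zero_iff vec_eq_iff zero_index)

lemma galois_conjugates_cnj:
  assumes "w \<in> galois_conjugates (of_real x)"
  shows "cnj w \<in> galois_conjugates (of_real x)"
proof -
  obtain p :: "rat poly" where p: "irreducible p" "poly (map_poly of_rat p) (complex_of_real x) = 0"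
    "poly (map_poly of_rat p) w = 0"
    using assms by (auto simp: galois_conjugates_def)
  have "cnj (complex_of_rat r) = complex_of_rat r" for r
    by (cases r) (simp add: of_rat_rat)
  then have "map_poly cnj (map_poly of_rat p) = map_poly of_rat p"
    by (simp add: map_poly_map_poly o_def)
  then have "poly (map_poly of_rat p) (cnj w) = 0"
    using poly_map_poly_cnj[of "map_poly of_rat p" "cnj w"] p(3) by simp
  with p show ?thesis by (auto simp: galois_conjugates_def)
qed

lemma pf_eigenvalue_eqI:
  assumes "is_pf_eigenvalue \<sigma> x" "x > 0"
  shows "pf_eigenvalue \<sigma> = x"
  unfolding pf_eigenvalue_def
proof (rule the_equality[where P = "is_pf_eigenvalue \<sigma>", OF assms(1)])
  fix y assume y: "is_pf_eigenvalue \<sigma> y"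
  then have "cmod (of_real x) \<le> y" "cmod (of_real y) \<le> x"
    using assms by (auto simp: is_pf_eigenvalue_def)
  with assms(2) show "y = x" by simp
qed

section \<open>The spectral decomposition\<close>

text \<open>The hypotheses form a locale so that the results can also be interpreted for
  \<open>reverse_subst \<sigma>\<close>.\<close>

locale unimodular_irreducible_pisot =
  fixes \<sigma> :: "'k::finite \<Rightarrow> 'k list"
  assumes unimodular: "unimodular_subst \<sigma>"
    and irreducible_pisot: "irreducible_pisot_subst \<sigma>"
begin

abbreviation M :: "real ^ 'k ^ 'k" where "M \<equiv> incidence_matrix \<sigma>"
abbreviation MC :: "complex ^ 'k ^ 'k" where "MC \<equiv> incidence_matrix \<sigma>"
abbreviation pf :: real where "pf \<equiv> pf_eigenvalue \<sigma>"

definition contracting_eigenvectors :: "(complex ^ 'k) set" where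
  "contracting_eigenvectors =
     {v. \<exists>\<mu> \<in> galois_conjugates (of_real pf) - {of_real pf}. eigenvector MC \<mu> v}"

lemma mem_contracting_space:
  "x \<in> contracting_space \<sigma> \<longleftrightarrow> cvec x \<in> vec.span contracting_eigenvectors"
  by (simp add: contracting_space_def contracting_eigenvectors_def cvec_def)

lemma pf_facts: "is_pf_eigenvalue \<sigma> pf" "pisot_number pf"
proof -
  obtain x where x: "is_pf_eigenvalue \<sigma> x" "pisot_number x"
    using irreducible_pisot by (auto simp: irreducible_pisot_subst_def pisot_subst_def)
  then have "pf = x" by (intro pf_eigenvalue_eqI) (auto simp: pisot_number_def)
  with x show "is_pf_eigenvalue \<sigma> pf" "pisot_number pf" by simp_all
qed

lemma pf_gt_1: "pf > 1"
  using pf_facts by (simp add: pisot_number_def)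

text \<open>The rational characteristic polynomial is irreducible and has both \<open>pf\<close> and
  \<open>\<mu>\<close> as roots.\<close>

lemma eigenvalue_galois_conjugate:
  assumes "eigenvalue MC \<mu>"
  shows "\<mu> \<in> galois_conjugates (of_real pf)"
  using assms pf_facts(1) irreducible_pisot
  unfolding galois_conjugates_def is_pf_eigenvalue_def irreducible_pisot_subst_def
    eigenvalue_iff_charpoly map_poly_of_rat_charpoly_incidence[symmetric]
  by auto

text \<open>The vectors with this property form a subspace; on a generator the powers act as
  \<open>\<mu> ^ n\<close>, and the Pisot condition gives modulus below 1.\<close>

lemma funpow_contracting_complex:
  assumes "z \<in> vec.span contracting_eigenvectors"
  shows "(\<lambda>n. ((*v) MC ^^ n) z $ i) \<longlonglongrightarrow> 0"
  using assms
proof (induction rule: vec.span_induct)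
  case base
  show ?case
    unfolding vec.subspace_def
  proof (intro conjI ballI allI; clarsimp)
    have "((*v) MC ^^ n) 0 = 0" for n by (induction n) simp_all
    then show "(\<lambda>n. ((*v) MC ^^ n) 0 $ i) \<longlonglongrightarrow> 0" by simp
  next
    fix x y
    assume "(\<lambda>n. ((*v) MC ^^ n) x $ i) \<longlonglongrightarrow> 0" "(\<lambda>n. ((*v) MC ^^ n) y $ i) \<longlonglongrightarrow> 0"
    then show "(\<lambda>n. ((*v) MC ^^ n) (x + y) $ i) \<longlonglongrightarrow> 0"
      using tendsto_add_zero by (simp add: funpow_mult_vec_linear)
  next
    fix c x
    assume "(\<lambda>n. ((*v) MC ^^ n) x $ i) \<longlonglongrightarrow> 0"
    then show "(\<lambda>n. ((*v) MC ^^ n) (c *s x) $ i) \<longlonglongrightarrow> 0"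
      using tendsto_mult_right_zero by (simp add: funpow_mult_vec_linear)
  qed
next
  case (step v)
  then obtain \<mu> where \<mu>: "\<mu> \<in> galois_conjugates (of_real pf) - {of_real pf}" "eigenvector MC \<mu> v"
    by (auto simp: contracting_eigenvectors_def)
  then have "cmod \<mu> < 1" using pf_facts(2) by (auto simp: pisot_number_def)
  then have "(\<lambda>n. \<mu> ^ n * v $ i) \<longlonglongrightarrow> 0"
    by (intro tendsto_mult_left_zero LIMSEQ_power_zero) auto
  then show ?case
    using \<mu>(2) by (simp add: eigenvector_def funpow_mult_vec_eigen)
qed

lemma contracting_expanding_disjoint_complex:
  assumes "z \<in> vec.span contracting_eigenvectors" "MC *v z = of_real pf *s z"
  shows "z = 0"
proof -
  have "z $ i = 0" for i
  proof (rule ccontr)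
    assume nz: "z $ i \<noteq> 0"
    have "(\<lambda>n. of_real pf ^ n * z $ i) \<longlonglongrightarrow> 0"
      using funpow_contracting_complex[OF assms(1), of i] by (simp add: funpow_mult_vec_eigen[OF assms(2)])
    then have "(\<lambda>n. (1 / z $ i) * (of_real pf ^ n * z $ i)) \<longlonglongrightarrow> 0"
      by (rule tendsto_mult_right_zero)
    then have "(\<lambda>n. complex_of_real (pf ^ n)) \<longlonglongrightarrow> complex_of_real 0"
      using nz by simp
    then have "(\<lambda>n. pf ^ n) \<longlonglongrightarrow> 0" by (simp only: tendsto_of_real_iff)
    then have "eventually (\<lambda>n. pf ^ n < 1) sequentially" by (rule order_tendstoD) simp
    then obtain n where "pf ^ n < 1" by (auto simp: eventually_sequentially)
    moreover have "pf ^ n \<ge> 1" using pf_gt_1 by (intro one_le_power) auto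
    ultimately show False by simp
  qed
  then show ?thesis by (simp add: vec_eq_iff)
qed

text \<open>An arbitrary choice: nothing is claimed about real or positive entries.\<close>

definition pf_vector :: "complex ^ 'k" where
  "pf_vector = (SOME v. eigenvector MC (of_real pf) v)"

lemma eigenvector_pf_vector: "eigenvector MC (of_real pf) pf_vector"
  using pf_facts(1) unfolding pf_vector_def is_pf_eigenvalue_def eigenvalue_def by (metis someI_ex)

lemma mult_pf_vector: "MC *v (c *s pf_vector) = of_real pf *s (c *s pf_vector)"
  using eigenvector_pf_vector by (simp add: eigenvector_def vec.scale vector_smult_assoc mult.commute)

text \<open>
  Irreducibility makes the eigenvalues of the incidence matrix simple, so that it is
  diagonalizable over \<open>\<complex>\<close>.
\<close>

lemma complex_decomposition:
  "\<exists>y c. y \<in> vec.span contracting_eigenvectors \<and> z = y + c *s pf_vector"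
proof -
  define S where "S = {\<mu>. eigenvalue MC \<mu>}"
  \<comment> \<open>One eigenvector per eigenvalue; at \<open>pf\<close> it is
    \<open>pf_vector\<close>, so all the others are contracting.\<close>
  define v where "v = (\<lambda>\<mu>. if \<mu> = of_real pf then pf_vector else SOME v. eigenvector MC \<mu> v)"
  have ev: "eigenvector MC \<mu> (v \<mu>)" if "\<mu> \<in> S" for \<mu>
    using that eigenvector_pf_vector unfolding S_def v_def eigenvalue_def
    by (auto intro: someI_ex)
  have S: "S = {\<mu>. poly (charpoly MC) \<mu> = 0}"
    by (simp add: S_def eigenvalue_iff_charpoly)
  have "rsquarefree (charpoly MC)"
    using irreducible_pisot unfolding map_poly_of_rat_charpoly_incidence[symmetric]
    by (intro irreducible_rat_poly_rsquarefree) (simp add: irreducible_pisot_subst_def)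
  then have "card S = CARD('k)"
    unfolding S by (simp add: card_roots_rsquarefree degree_charpoly)
  \<comment> \<open>\<open>card\<close> is 0 on infinite sets, so positive cardinality gives
    finiteness.\<close>
  moreover from this have "finite S"
    by (intro card_ge_0_finite) simp
  ultimately have "vec.span (v ` S) = UNIV"
    using ev by (intro span_eigenvectors) auto
  moreover have "v \<mu> \<in> insert pf_vector contracting_eigenvectors" if "\<mu> \<in> S" for \<mu>
  proof (cases "\<mu> = of_real pf")
    case True
    then show ?thesis by (simp add: v_def)
  next
    case False
    with that show ?thesis
      using ev[OF that] eigenvalue_galois_conjugate[of \<mu>]
      unfolding contracting_eigenvectors_def S_def by blast
  qed
  then have "v ` S \<subseteq> insert pf_vector contracting_eigenvectors" by blast
  ultimately have "z \<in> vec.span (insert pf_vector contracting_eigenvectors)"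
    using vec.span_mono by blast
  then obtain c where "z - c *s pf_vector \<in> vec.span contracting_eigenvectors"
    unfolding vec.span_insert by auto
  then show ?thesis by (intro exI[of _ "z - c *s pf_vector"] exI[of _ c]) simp
qed

text \<open>As \<open>pf\<close> is real, conjugation permutes the Galois conjugates other than
  \<open>pf\<close>, and with them the contracting eigenvectors.\<close>

lemma conj_vec_contracting:
  assumes "z \<in> vec.span contracting_eigenvectors"
  shows "conj_vec z \<in> vec.span contracting_eigenvectors"
  using assms
proof (induction rule: vec.span_induct)
  case base
  show ?case
    by (auto simp: vec.subspace_def conj_vec_simps vec.span_zero vec.span_add vec.span_scale)
next
  case (step v)
  then have "conj_vec v \<in> contracting_eigenvectors"
    using eigenvector_conj galois_conjugates_cnj
    by (fastforce simp: contracting_eigenvectors_def complex_cnj_cancel_iff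
        dest: arg_cong[of _ _ cnj])
  then show ?case by (rule vec.span_base)
qed

lemma mem_expanding_space: "x \<in> expanding_space \<sigma> \<longleftrightarrow> M *v x = pf *s x"
  by (simp add: expanding_space_def)

lemma real_decomposition: "\<exists>y. y \<in> contracting_space \<sigma> \<and> x - y \<in> expanding_space \<sigma>"
proof -
  obtain z c where z: "z \<in> vec.span contracting_eigenvectors" "cvec x = z + c *s pf_vector"
    using complex_decomposition by blast
  define w where "w = c *s pf_vector"
  define y :: "real ^ 'k" where "y = (\<chi> i. Re (z $ i))"
  \<comment> \<open>Taking real parts is averaging with the conjugate, which keeps the vector in the
    span.\<close>
  have "cvec y = (1/2) *s (z + conj_vec z)"
    by (simp add: vec_eq_iff y_def complex_eq_iff)
  then have "y \<in> contracting_space \<sigma>"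
    unfolding mem_contracting_space
    using z(1) conj_vec_contracting by (simp add: vec.span_add vec.span_scale)
  moreover have "x - y \<in> expanding_space \<sigma>"
  proof -
    \<comment> \<open>Since \<open>x\<close> is real, \<open>x - y\<close> is the real part of the
      component \<open>w\<close> along \<open>pf_vector\<close>, and a real matrix commutes with
      real parts.\<close>
    have Re_w: "(x - y) $ i = Re (w $ i)" for i
      using arg_cong[OF z(2), of "\<lambda>v. Re (v $ i)"] by (simp add: y_def w_def)
    have "(M *v (x - y)) $ i = pf * Re (w $ i)" for i
    proof -
      have "(M *v (x - y)) $ i = Re ((MC *v w) $ i)"
        by (simp add: matrix_vector_mult_def incidence_matrix_def Re_w del: vector_minus_component)
      also have "\<dots> = Re ((of_real pf *s w) $ i)"
        by (simp only: w_def mult_pf_vector)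
      finally show ?thesis by simp
    qed
    then show ?thesis
      unfolding mem_expanding_space vec_eq_iff vector_smult_component Re_w by blast
  qed
  ultimately show ?thesis by blast
qed

lemma contracting_expanding_disjoint:
  assumes "x \<in> contracting_space \<sigma>" "x \<in> expanding_space \<sigma>"
  shows "x = 0"
proof -
  have "cvec x = 0"
    using assms unfolding mem_contracting_space mem_expanding_space
    by (intro contracting_expanding_disjoint_complex)
       (simp_all add: cvec_mult_incidence[symmetric] cvec_simps)
  then show ?thesis by (simp add: vec_eq_iff)
qed

lemma contracting_space_closed:
  assumes "x \<in> contracting_space \<sigma>" "y \<in> contracting_space \<sigma>"
  shows "x + y \<in> contracting_space \<sigma>" "x - y \<in> contracting_space \<sigma>" "- x \<in> contracting_space \<sigma>"
  using assms by (simp_all add: mem_contracting_space cvec_simps vec.span_add vec.span_diff vec.span_neg)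

lemma expanding_space_closed:
  assumes "x \<in> expanding_space \<sigma>" "y \<in> expanding_space \<sigma>"
  shows "x + y \<in> expanding_space \<sigma>" "x - y \<in> expanding_space \<sigma>" "- x \<in> expanding_space \<sigma>"
  using assms by (simp_all add: mem_expanding_space vec.add vec.diff vec.neg
      vec.scale_right_distrib vec.scale_right_diff_distrib)

lemma mult_contracting_space:
  assumes "x \<in> contracting_space \<sigma>"
  shows "M *v x \<in> contracting_space \<sigma>"
proof -
  have "MC *v z \<in> vec.span contracting_eigenvectors" if "z \<in> vec.span contracting_eigenvectors" for z
    using that
  proof (induction rule: vec.span_induct)
    case base
    show ?case
      by (auto simp: vec.subspace_def vec.add vec.scale vec.span_zero vec.span_add vec.span_scale)
  next
    case (step v)
    then obtain \<mu> where "MC *v v = \<mu> *s v"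
      by (auto simp: contracting_eigenvectors_def eigenvector_def)
    then show ?case using step by (simp add: vec.span_base vec.span_scale)
  qed
  then show ?thesis using assms by (simp add: mem_contracting_space cvec_mult_incidence)
qed

lemma mult_expanding_space: "x \<in> expanding_space \<sigma> \<Longrightarrow> M *v x \<in> expanding_space \<sigma>"
  by (simp add: mem_expanding_space vec.scale)

section \<open>The projection along the expanding space\<close>

lemma contracting_proj_eqI:
  assumes "y \<in> contracting_space \<sigma>" "x - y \<in> expanding_space \<sigma>"
  shows "contracting_proj \<sigma> x = y"
  unfolding contracting_proj_def
proof (rule the_equality)
  fix z assume z: "z \<in> contracting_space \<sigma> \<and> x - z \<in> expanding_space \<sigma>"
  have "z - y \<in> expanding_space \<sigma>"
    using expanding_space_closed(2)[of "x - y" "x - z"] assms z by simp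
  then have "z - y = 0"
    using assms z by (intro contracting_expanding_disjoint contracting_space_closed) auto
  then show "z = y" by simp
qed (use assms in simp)

lemma contracting_proj:
  "contracting_proj \<sigma> x \<in> contracting_space \<sigma>" "x - contracting_proj \<sigma> x \<in> expanding_space \<sigma>"
  using real_decomposition[of x] contracting_proj_eqI by auto

lemma contracting_proj_add:
  "contracting_proj \<sigma> (x + y) = contracting_proj \<sigma> x + contracting_proj \<sigma> y"
  using contracting_proj[of x] contracting_proj[of y]
  by (intro contracting_proj_eqI) (auto simp: contracting_space_closed add_diff_add expanding_space_closed)

lemma contracting_proj_minus: "contracting_proj \<sigma> (- x) = - contracting_proj \<sigma> x"
  using contracting_proj[of x] expanding_space_closed(3)[of "x - contracting_proj \<sigma> x"]
  by (intro contracting_proj_eqI) (auto simp: contracting_space_closed)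

lemma contracting_proj_funpow:
  "contracting_proj \<sigma> (((*v) M ^^ n) x) = ((*v) M ^^ n) (contracting_proj \<sigma> x)"
proof (induction n)
  case (Suc n)
  have "contracting_proj \<sigma> (M *v y) = M *v contracting_proj \<sigma> y" for y
    using contracting_proj[of y] mult_expanding_space[OF contracting_proj(2)[of y]]
    by (intro contracting_proj_eqI) (auto simp: mult_contracting_space vec.diff)
  with Suc show ?case by simp
qed simp

lemma funpow_contracting:
  assumes "x \<in> contracting_space \<sigma>"
  shows "(\<lambda>n. ((*v) M ^^ n) x) \<longlonglongrightarrow> 0"
proof (rule vec_tendstoI)
  fix i
  have "(\<lambda>n. complex_of_real (((*v) M ^^ n) x $ i)) \<longlonglongrightarrow> complex_of_real 0"
    using funpow_contracting_complex[of "cvec x" i] assms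
    by (simp add: mem_contracting_space cvec_funpow_incidence[symmetric])
  then show "(\<lambda>n. ((*v) M ^^ n) x $ i) \<longlonglongrightarrow> 0 $ i"
    by (simp only: tendsto_of_real_iff zero_index)
qed

text \<open>The eigenspace of \<open>pf\<close> is a line: the contracting part of such a vector
  again satisfies the eigenvector equation for \<open>pf\<close>, hence is 0.\<close>

lemma expanding_space_pf_vector:
  assumes "x \<in> expanding_space \<sigma>"
  obtains c where "cvec x = c *s pf_vector"
proof -
  obtain y c where y: "y \<in> vec.span contracting_eigenvectors" "cvec x = y + c *s pf_vector"
    using complex_decomposition by blast
  have "MC *v cvec x = of_real pf *s cvec x"
    using assms by (simp add: mem_expanding_space cvec_mult_incidence[symmetric] cvec_simps)
  moreover have "y = cvec x - c *s pf_vector" using y by simp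
  ultimately have "MC *v y = of_real pf *s y"
    by (simp only: vec.diff mult_pf_vector vec.scale_right_diff_distrib)
  then have "y = 0" using y contracting_expanding_disjoint_complex by blast
  with y that[of c] show ?thesis by simp
qed

end

section \<open>Words and fixed points\<close>

definition subst_word :: "('k \<Rightarrow> 'k list) \<Rightarrow> 'k list \<Rightarrow> 'k list" where
  "subst_word \<sigma> w = concat (map \<sigma> w)"

definition abelianization :: "'k list \<Rightarrow> real ^ 'k" where
  "abelianization w = (\<chi> i. real (count_list w i))"

definition initial_word :: "(int \<Rightarrow> 'k) \<Rightarrow> nat \<Rightarrow> 'k list" where
  "initial_word u n = map (\<lambda>i. u (int i)) [0..<n]"

text \<open>The centre of reflection lies between positions -1 and 0, so the two halves of
  \<open>u\<close> are exchanged and \<open>u (- 1)\<close> becomes the letter at 0.\<close>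

definition reflect :: "(int \<Rightarrow> 'k) \<Rightarrow> int \<Rightarrow> 'k" where
  "reflect u n = u (- 1 - n)"

lemma subst_word_simps [simp]:
  "subst_word \<sigma> [] = []" "subst_word \<sigma> (a # w) = \<sigma> a @ subst_word \<sigma> w"
  "subst_word \<sigma> (v @ w) = subst_word \<sigma> v @ subst_word \<sigma> w"
  by (simp_all add: subst_word_def)

lemma funpow_subst_word_append:
  "(subst_word \<sigma> ^^ n) (v @ w) = (subst_word \<sigma> ^^ n) v @ (subst_word \<sigma> ^^ n) w"
  by (induction n) simp_all

lemma funpow_subst_word_reverse:
  "(subst_word (reverse_subst \<sigma>) ^^ n) w = rev ((subst_word \<sigma> ^^ n) (rev w))"
proof (induction n)
  case (Suc n)
  have "subst_word (reverse_subst \<sigma>) v = rev (subst_word \<sigma> (rev v))" for v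
    by (induction v) (simp_all add: reverse_subst_def)
  with Suc show ?case by simp
qed simp

lemma abelianization_simps [simp]:
  "abelianization [] = 0" "abelianization (v @ w) = abelianization v + abelianization w"
  "abelianization (rev w) = abelianization w"
  by (simp_all add: abelianization_def vec_eq_iff)

lemma abelianization_Cons: "abelianization (a # w) = axis a 1 + abelianization w"
  by (simp add: abelianization_def vec_eq_iff axis_def)

lemma abelianization_nth [simp]: "abelianization w $ i = real (count_list w i)"
  by (simp add: abelianization_def)

lemma abelianization_subst_word:
  "abelianization (subst_word \<sigma> w) = incidence_matrix \<sigma> *v abelianization w"
proof (induction w)
  case (Cons a w)
  have "incidence_matrix \<sigma> *v axis a 1 = abelianization (\<sigma> a)"
    by (simp add: matrix_vector_mult_basis column_def incidence_matrix_def vec_eq_iff)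
  with Cons show ?case by (simp add: abelianization_Cons vec.add)
qed (simp add: vec.zero)

lemma abelianization_funpow:
  "abelianization ((subst_word \<sigma> ^^ n) w) = ((*v) (incidence_matrix \<sigma>) ^^ n) (abelianization w)"
  by (induction n) (simp_all add: abelianization_subst_word)

lemma length_initial_word [simp]: "length (initial_word u n) = n"
  by (simp add: initial_word_def)

lemma nth_initial_word [simp]: "i < n \<Longrightarrow> initial_word u n ! i = u (int i)"
  by (simp add: initial_word_def)

lemma initial_word_Suc: "initial_word u (Suc n) = initial_word u n @ [u (int n)]"
  by (simp add: initial_word_def)

lemma initial_word_split:
  assumes "m \<le> n"
  shows "initial_word u n = initial_word u m @ drop m (initial_word u n)"
proof -
  have "take m (initial_word u n) = initial_word u m"
    using assms by (intro nth_equalityI) auto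
  then show ?thesis by (metis append_take_drop_id)
qed

lemma map_upto_initial_word: "map u [0..int n] = initial_word u (Suc n)"
  by (intro nth_equalityI) auto

lemma length_subst_word_ge:
  assumes "\<And>a. \<sigma> a \<noteq> []"
  shows "length w \<le> length (subst_word \<sigma> w)"
proof (induction w)
  case (Cons a w)
  have "length (\<sigma> a) > 0" unfolding length_greater_0_conv by (rule assms)
  then have "Suc 0 \<le> length (\<sigma> a)" by (rule Suc_leI)
  from add_mono[OF this Cons] show ?case by simp
qed simp

lemma fixed_point_nth:
  assumes "fixed_point \<sigma> u"
  shows "subst_word \<sigma> (initial_word u (Suc n)) ! n = u (int n)"
proof -
  have "u (int n) = subst_seq \<sigma> u (int n)" using assms by (simp add: fixed_point_def)
  also have "\<dots> = subst_word \<sigma> (map u [0..int n]) ! n"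
    by (simp add: subst_seq_def subst_word_def o_def)
  finally show ?thesis by (simp add: map_upto_initial_word)
qed

text \<open>\<open>subst_seq\<close> reads the letter at \<open>i\<close> in the image of the first
  \<open>i + 1\<close> letters. As no image is empty, that word has more than \<open>i\<close>
  letters, and images of longer prefixes extend it.\<close>

lemma subst_word_initial_word:
  assumes fp: "fixed_point \<sigma> u" and ne: "\<And>a. \<sigma> a \<noteq> []"
  shows "subst_word \<sigma> (initial_word u m) = initial_word u (length (subst_word \<sigma> (initial_word u m)))"
proof (intro nth_equalityI)
  fix i assume i: "i < length (subst_word \<sigma> (initial_word u m))"
  define n where "n = max m (Suc i)"
  have "subst_word \<sigma> (initial_word u m) ! i = subst_word \<sigma> (initial_word u n) ! i"
    by (subst (2) initial_word_split[of m]) (use i in \<open>auto simp: n_def nth_append\<close>)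
  moreover have "subst_word \<sigma> (initial_word u (Suc i)) ! i = subst_word \<sigma> (initial_word u n) ! i"
    using length_subst_word_ge[of \<sigma> "initial_word u (Suc i)"] ne
    by (subst (2) initial_word_split[of "Suc i"]) (auto simp: n_def nth_append)
  ultimately show "subst_word \<sigma> (initial_word u m) ! i
      = initial_word u (length (subst_word \<sigma> (initial_word u m))) ! i"
    using i fixed_point_nth[OF fp, of i] by simp
qed simp

lemma funpow_subst_word_fixed_point:
  assumes fp: "fixed_point \<sigma> u" and ne: "\<And>a. \<sigma> a \<noteq> []"
  shows "\<exists>m. (subst_word \<sigma> ^^ n) [u 0] = initial_word u m"
proof (induction n)
  case 0
  show ?case by (rule exI[of _ 1]) (simp add: initial_word_def)
next
  case (Suc n)
  then show ?case using subst_word_initial_word[OF fp ne] by auto metis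
qed

lemma map_uminus_upto: "map (\<lambda>i. - 1 - i) [0..n] = rev [- 1 - n..- 1]"
  by (intro nth_equalityI) (auto simp: rev_nth)

text \<open>Reflection exchanges the two branches of \<open>subst_seq\<close>, and reversing the
  images compensates for the opposite reading direction.\<close>

lemma fixed_point_reflect:
  assumes "fixed_point \<sigma> u"
  shows "fixed_point (reverse_subst \<sigma>) (reflect u)"
proof -
  have concat_rev: "concat (map (\<lambda>i. rev (f i)) (rev xs)) = rev (concat (map f xs))"
    for f :: "int \<Rightarrow> 'a list" and xs
    by (induction xs) auto
  have "subst_seq (reverse_subst \<sigma>) (reflect u) n = subst_seq \<sigma> u (- 1 - n)" for n
  proof (cases "n \<ge> 0")
    case True
    have "map (\<lambda>i. reverse_subst \<sigma> (reflect u i)) [0..n]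
        = map (\<lambda>i. rev (\<sigma> (u i))) (map (\<lambda>i. - 1 - i) [0..n])"
      by (simp add: reverse_subst_def reflect_def)
    with True show ?thesis
      unfolding map_uminus_upto by (simp add: subst_seq_def concat_rev)
  next
    case False
    have "map (\<lambda>i. reverse_subst \<sigma> (reflect u i)) [n..- 1]
        = map (\<lambda>i. rev (\<sigma> (u i))) (rev (rev (map (\<lambda>i. - 1 - i) [n..- 1])))"
      by (simp add: reverse_subst_def reflect_def)
    \<comment> \<open>Reflecting twice is the identity; the range is rewritten to start at 0, the
      form handled by \<open>map_uminus_upto\<close>.\<close>
    also have "rev (map (\<lambda>i. - 1 - i) [n..- 1]) = map (\<lambda>i. - 1 - i) (map (\<lambda>i. - 1 - i) [0..- 1 - n])"
      unfolding map_uminus_upto by (simp add: rev_map)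
    finally have "map (\<lambda>i. reverse_subst \<sigma> (reflect u i)) [n..- 1]
        = map (\<lambda>i. rev (\<sigma> (u i))) (rev [0..- 1 - n])" by (simp add: o_def)
    moreover have swap: "- 1 - n = - n - 1" by simp
    ultimately show ?thesis
      using False unfolding swap by (simp add: subst_seq_def concat_rev)
  qed
  with assms show ?thesis by (simp add: fixed_point_def fun_eq_iff reflect_def)
qed

lemma broken_line_nonneg: "broken_line u (int n) = abelianization (initial_word u n)"
proof (induction n)
  case (Suc n)
  have "{0..int (Suc n) - 1} = insert (int n) {0..int n - 1}" by auto
  with Suc show ?case
    by (simp add: broken_line_def initial_word_Suc abelianization_Cons add.commute)
qed (simp add: broken_line_def initial_word_def)

text \<open>The index is \<open>- n\<close>, not \<open>- 1 - n\<close>, since vertices sit between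
  letters: vertex 0 is fixed by the reflection.\<close>

lemma broken_line_reflect: "broken_line (reflect u) n = - broken_line u (- n)"
proof -
  have sum: "(\<Sum>i = 0..m - 1. axis (f (- 1 - i)) (1::real)) = (\<Sum>i = - m..- 1. axis (f i) 1)"
    for f :: "int \<Rightarrow> 'a" and m
    by (rule sum.reindex_bij_witness[of _ "\<lambda>i. - 1 - i" "\<lambda>i. - 1 - i"]) auto
  consider "n = 0" | "n > 0" | "n < 0" by linarith
  then show ?thesis
  proof cases
    case 2
    then show ?thesis using sum[of u n] by (simp add: broken_line_def reflect_def)
  next
    case 3
    then show ?thesis
      using sum[of "reflect u" "- n"] by (simp add: broken_line_def reflect_def)
  qed (simp add: broken_line_def)
qed

text \<open>An empty image would be a zero column of a matrix with nonzero determinant; similarly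
  below, a letter in no image would give a zero row.\<close>

lemma (in unimodular_irreducible_pisot) nonerasing: "\<sigma> a \<noteq> []"
proof
  assume "\<sigma> a = []"
  then have "column a (incidence_matrix \<sigma> :: int ^ 'k ^ 'k) = 0"
    by (simp add: column_def incidence_matrix_def vec_eq_iff)
  with det_zero_column(1) unimodular show False by (fastforce simp: unimodular_subst_def)
qed

lemma (in unimodular_irreducible_pisot) letter_occurs: "\<exists>a. b \<in> set (\<sigma> a)"
proof (rule ccontr)
  assume "\<nexists>a. b \<in> set (\<sigma> a)"
  then have "row b (incidence_matrix \<sigma> :: int ^ 'k ^ 'k) = 0"
    by (simp add: row_def incidence_matrix_def vec_eq_iff count_list_0_iff)
  with det_zero_row(1) unimodular show False by (fastforce simp: unimodular_subst_def)
qed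

section \<open>Independence of the fixed point\<close>

context unimodular_irreducible_pisot
begin

section \<open>Growth of letter counts\<close>

lemma funpow_decomposition:
  "((*v) M ^^ n) x $ i
     = ((*v) M ^^ n) (contracting_proj \<sigma> x) $ i + pf ^ n * (x - contracting_proj \<sigma> x) $ i"
proof -
  have "((*v) M ^^ n) x = ((*v) M ^^ n) (contracting_proj \<sigma> x + (x - contracting_proj \<sigma> x))"
    by simp
  also have "\<dots> = ((*v) M ^^ n) (contracting_proj \<sigma> x) + pf ^ n *s (x - contracting_proj \<sigma> x)"
    unfolding funpow_mult_vec_linear(1)
    using contracting_proj(2)[of x] by (simp only: mem_expanding_space funpow_mult_vec_eigen)
  finally show ?thesis by (simp add: right_diff_distrib)
qed

lemma count_list_funpow:
  "real (count_list ((subst_word \<sigma> ^^ n) [a]) b) = ((*v) M ^^ n) (axis a 1) $ b"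
  using abelianization_funpow[of n \<sigma> "[a]", THEN arg_cong[where f = "\<lambda>v. v $ b"]]
  by (simp add: abelianization_Cons)

lemma funpow_proj_nth: "(\<lambda>n. ((*v) M ^^ n) (contracting_proj \<sigma> x) $ i) \<longlonglongrightarrow> 0"
  using tendsto_vec_nth[OF funpow_contracting[OF contracting_proj(1)], of x i] by simp

lemma letter_occurs_funpow: "\<exists>a. b \<in> set ((subst_word \<sigma> ^^ n) [a])"
proof (induction n arbitrary: b)
  case (Suc n)
  obtain c where c: "b \<in> set (\<sigma> c)" using letter_occurs by blast
  obtain a where "c \<in> set ((subst_word \<sigma> ^^ n) [a])" using Suc by blast
  with c have "b \<in> set ((subst_word \<sigma> ^^ Suc n) [a])" by (auto simp: subst_word_def)
  then show ?case by blast
qed auto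

text \<open>
  If the entry vanished, then the \<open>b\<close>-th row of the \<open>n\<close>-th power of the incidence matrix, an
  integer vector, would tend to 0.
\<close>

lemma pf_vector_nonzero: "pf_vector $ b \<noteq> 0"
proof
  assume 0: "pf_vector $ b = 0"
  have lim: "(\<lambda>n. real (count_list ((subst_word \<sigma> ^^ n) [a]) b)) \<longlonglongrightarrow> 0" for a
  proof -
    \<comment> \<open>The expanding part of \<open>axis a 1\<close> is a multiple of
      \<open>pf_vector\<close>, so its coordinate at \<open>b\<close> vanishes and the count is left
      with the part tending to 0.\<close>
    obtain c where "cvec (axis a 1 - contracting_proj \<sigma> (axis a 1)) = c *s pf_vector"
      using expanding_space_pf_vector contracting_proj(2) by blast
    from arg_cong[OF this, of "\<lambda>v. v $ b"] 0
    have "(axis a 1 - contracting_proj \<sigma> (axis a 1)) $ b = 0" by simp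
    then show ?thesis
      unfolding count_list_funpow by (subst funpow_decomposition) (simp add: funpow_proj_nth)
  qed
  have "(\<lambda>n. \<Sum>a\<in>UNIV. real (count_list ((subst_word \<sigma> ^^ n) [a]) b)) \<longlonglongrightarrow> 0"
    using tendsto_sum[of UNIV, OF lim] by simp
  then have "eventually (\<lambda>n. (\<Sum>a\<in>UNIV. real (count_list ((subst_word \<sigma> ^^ n) [a]) b)) < 1) sequentially"
    by (rule order_tendstoD) simp
  then obtain n where n: "(\<Sum>a\<in>UNIV. real (count_list ((subst_word \<sigma> ^^ n) [a]) b)) < 1"
    by (auto simp: eventually_sequentially)
  \<comment> \<open>For this very \<open>n\<close> some letter has \<open>b\<close> in its image, so
    the sum of counts is at least 1.\<close>
  obtain a where "b \<in> set ((subst_word \<sigma> ^^ n) [a])" using letter_occurs_funpow by blast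
  then have "1 \<le> real (count_list ((subst_word \<sigma> ^^ n) [a]) b)"
    using count_list_0_iff[of "(subst_word \<sigma> ^^ n) [a]" b] by linarith
  also have "\<dots> \<le> (\<Sum>a\<in>UNIV. real (count_list ((subst_word \<sigma> ^^ n) [a]) b))"
    by (rule member_le_sum) auto
  finally show False using n by simp
qed

text \<open>Otherwise the count of each letter in the iterated images of \<open>a\<close> would tend
  to 0, and with it their length, which stays at least 1.\<close>

lemma axis_not_contracting: "axis a 1 - contracting_proj \<sigma> (axis a 1) \<noteq> 0"
proof
  assume 0: "axis a 1 - contracting_proj \<sigma> (axis a 1) = 0"
  have "(\<lambda>n. real (count_list ((subst_word \<sigma> ^^ n) [a]) b)) \<longlonglongrightarrow> 0" for b
    unfolding count_list_funpow
    by (subst funpow_decomposition) (simp add: funpow_proj_nth 0 del: vector_minus_component)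
  then have "(\<lambda>n. \<Sum>b\<in>UNIV. real (count_list ((subst_word \<sigma> ^^ n) [a]) b)) \<longlonglongrightarrow> (\<Sum>b\<in>(UNIV :: 'k set). 0)"
    by (intro tendsto_sum)
  moreover have "(\<Sum>b\<in>UNIV. real (count_list w b)) = real (length w)" for w :: "'k list"
    using sum_count_set[of w UNIV] by (simp flip: of_nat_sum)
  ultimately have "(\<lambda>n. real (length ((subst_word \<sigma> ^^ n) [a]))) \<longlonglongrightarrow> 0" by simp
  then have "eventually (\<lambda>n. real (length ((subst_word \<sigma> ^^ n) [a])) < 1) sequentially"
    by (rule order_tendstoD) simp
  then obtain n where "length ((subst_word \<sigma> ^^ n) [a]) < 1"
    by (auto simp: eventually_sequentially)
  moreover have "length ((subst_word \<sigma> ^^ n) [a]) \<ge> 1"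
  proof (induction n)
    case (Suc n)
    then show ?case
      using length_subst_word_ge[of \<sigma> "(subst_word \<sigma> ^^ n) [a]"] nonerasing by simp
  qed simp
  ultimately show False by simp
qed

text \<open>The count is a null sequence plus \<open>pf ^ n * w $ b\<close>. Here
  \<open>w $ b\<close> is nonzero because \<open>w\<close> is a nonzero multiple of
  \<open>pf_vector\<close>, and positive because counts are nonnegative.\<close>

lemma count_list_at_top: "LIM n sequentially. real (count_list ((subst_word \<sigma> ^^ n) [a]) b) :> at_top"
proof -
  define w where "w = axis a 1 - contracting_proj \<sigma> (axis a 1)"
  define f where "f n = ((*v) M ^^ n) (contracting_proj \<sigma> (axis a 1)) $ b" for n
  have f: "f \<longlonglongrightarrow> 0" unfolding f_def by (rule funpow_proj_nth)
  have count: "real (count_list ((subst_word \<sigma> ^^ n) [a]) b) = f n + pf ^ n * w $ b" for n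
    unfolding count_list_funpow by (subst funpow_decomposition) (simp add: f_def w_def)
  obtain c where c: "cvec w = c *s pf_vector"
    using expanding_space_pf_vector contracting_proj(2) unfolding w_def by blast
  have "c \<noteq> 0" using c axis_not_contracting[of a] by (auto simp: w_def[symmetric] vec_eq_iff)
  then have "w $ b \<noteq> 0"
    using arg_cong[OF c, of "\<lambda>v. v $ b"] pf_vector_nonzero[of b] by auto
  moreover have "\<not> w $ b < 0"
  proof
    assume neg: "w $ b < 0"
    \<comment> \<open>Once \<open>f n\<close> is below \<open>- w $ b\<close>, the count is
      negative, since \<open>pf ^ n * w $ b\<close> is at most \<open>w $ b\<close>.\<close>
    then have "eventually (\<lambda>n. f n < - w $ b) sequentially"
      using f by (intro order_tendstoD) auto
    then obtain n where "f n < - w $ b" by (auto simp: eventually_sequentially)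
    moreover have "pf ^ n * w $ b \<le> 1 * w $ b"
      using neg pf_gt_1 by (intro mult_right_mono_neg one_le_power) auto
    ultimately have "real (count_list ((subst_word \<sigma> ^^ n) [a]) b) < 0"
      unfolding count by simp
    then show False by simp
  qed
  ultimately have "w $ b > 0" by simp
  moreover have "LIM n sequentially. pf ^ n :> at_top"
    using pf_gt_1 by (intro filterlim_at_infinity_imp_filterlim_at_top
        filterlim_realpow_sequentially_gt1) auto
  ultimately have "LIM n sequentially. w $ b * pf ^ n :> at_top"
    by (intro filterlim_tendsto_pos_mult_at_top[OF tendsto_const])
  then show ?thesis
    unfolding count by (intro filterlim_tendsto_add_at_top[OF f]) (simp add: mult.commute)
qed

lemma letter_reachable: "\<exists>n. b \<in> set ((subst_word \<sigma> ^^ n) [a])"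
proof -
  have "eventually (\<lambda>n. real (count_list ((subst_word \<sigma> ^^ n) [a]) b) > 0) sequentially"
    using count_list_at_top[of a b] unfolding filterlim_at_top_dense by blast
  then obtain n where "count_list ((subst_word \<sigma> ^^ n) [a]) b > 0"
    by (auto simp: eventually_sequentially)
  then show ?thesis by (metis count_notin less_irrefl)
qed

text \<open>The iterated images of \<open>u 0\<close> are prefixes of \<open>u\<close>, and their
  length tends to infinity, being at least the count of the single letter
  \<open>u 0\<close>.\<close>

lemma eventually_initial_word:
  assumes "fixed_point \<sigma> u"
  shows "eventually (\<lambda>n. \<exists>S. (subst_word \<sigma> ^^ n) [u 0] = initial_word u m @ S) sequentially"
proof -
  have "eventually (\<lambda>n. real (count_list ((subst_word \<sigma> ^^ n) [u 0]) (u 0)) \<ge> real m) sequentially"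
    using count_list_at_top[of "u 0" "u 0"] unfolding filterlim_at_top by blast
  then show ?thesis
  proof eventually_elim
    case (elim n)
    obtain l where l: "(subst_word \<sigma> ^^ n) [u 0] = initial_word u l"
      using funpow_subst_word_fixed_point[OF assms nonerasing] by blast
    have "m \<le> l"
      using elim count_le_length[of "(subst_word \<sigma> ^^ n) [u 0]" "u 0"] by (simp add: l)
    then show ?case unfolding l using initial_word_split by blast
  qed
qed

text \<open>
  The \<open>n\<close>-th image of any letter \<open>b\<close> occurs in \<open>u\<close>, at a position whose projection tends to 0;
  so the limits of projected prefixes of these images belong to the fractal.
\<close>

lemma mem_closure_initial_words:
  assumes u: "fixed_point \<sigma> u"
    and ev: "eventually (\<lambda>n. \<exists>P S. (subst_word \<sigma> ^^ n) [b] = P @ S \<and>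
               abelianization P = x + ((*v) M ^^ n) y) sequentially"
  shows "contracting_proj \<sigma> x \<in> closure (range (\<lambda>m. contracting_proj \<sigma> (abelianization (initial_word u m))))"
    (is "_ \<in> closure ?R")
proof -
  \<comment> \<open>Applying \<open>\<sigma>\<close> to this factorisation \<open>n\<close> times
    places the \<open>n\<close>-th image of \<open>b\<close> inside \<open>u\<close>, right after
    that of \<open>X\<close>.\<close>
  obtain N X Y where N: "(subst_word \<sigma> ^^ N) [u 0] = X @ b # Y"
    using letter_reachable[of b "u 0"] by (auto dest: split_list)
  \<comment> \<open>\<open>f n\<close> is the projected vertex at the end of \<open>P\<close> in
    that occurrence; all terms except \<open>x\<close> are collected under the \<open>n\<close>-th
    power of \<open>M\<close>.\<close>
  define f where "f n = contracting_proj \<sigma> x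
      + ((*v) M ^^ n) (contracting_proj \<sigma> (abelianization X + y))" for n
  have "eventually (\<lambda>n. f n \<in> ?R) sequentially"
    using ev
  proof eventually_elim
    case (elim n)
    then obtain P S where P: "(subst_word \<sigma> ^^ n) [b] = P @ S"
      "abelianization P = x + ((*v) M ^^ n) y" by blast
    obtain l where l: "(subst_word \<sigma> ^^ (n + N)) [u 0] = initial_word u l"
      using funpow_subst_word_fixed_point[OF u nonerasing] by blast
    define Q where "Q = (subst_word \<sigma> ^^ n) X @ P"
    have "(subst_word \<sigma> ^^ (n + N)) [u 0] = (subst_word \<sigma> ^^ n) (X @ [b] @ Y)"
      by (simp add: funpow_add N)
    also have "\<dots> = Q @ S @ (subst_word \<sigma> ^^ n) Y"
      unfolding funpow_subst_word_append by (simp add: P Q_def)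
    finally have Q: "initial_word u l = Q @ S @ (subst_word \<sigma> ^^ n) Y" by (simp add: l)
    then have "length Q \<le> l" by (metis length_append length_initial_word le_add1)
    from trans[OF initial_word_split[OF this, symmetric] Q] have "Q = initial_word u (length Q)" by (subst (asm) append_eq_append_conv) simp_all
    then obtain q where q: "Q = initial_word u q" by blast
    have "contracting_proj \<sigma> (abelianization Q) = f n"
      by (simp add: Q_def f_def P abelianization_funpow contracting_proj_add
          contracting_proj_funpow funpow_mult_vec_linear(1))
    then have "f n = contracting_proj \<sigma> (abelianization (initial_word u q))" by (simp add: q)
    then show ?case by (rule range_eqI)
  qed
  then have "eventually (\<lambda>n. f n \<in> closure ?R) sequentially"
    by (rule eventually_mono) (rule subsetD[OF closure_subset])
  moreover have "f \<longlonglongrightarrow> contracting_proj \<sigma> x + 0"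
    unfolding f_def by (intro tendsto_intros funpow_contracting contracting_proj)
  ultimately show ?thesis
    by (intro Lim_in_closed_set[of "closure ?R" f sequentially]) simp_all
qed

section \<open>Reversal and comparison of two fixed points\<close>

lemma unimodular_irreducible_pisot_reverse: "unimodular_irreducible_pisot (reverse_subst \<sigma>)"
  using unimodular irreducible_pisot
  by unfold_locales
     (simp_all add: unimodular_subst_def irreducible_pisot_subst_def pisot_subst_def
        is_pf_eigenvalue_def incidence_matrix_reverse)

lemma contracting_proj_reverse: "contracting_proj (reverse_subst \<sigma>) = contracting_proj \<sigma>"
  by (simp add: contracting_proj_def fun_eq_iff contracting_space_def expanding_space_def
      pf_eigenvalue_def is_pf_eigenvalue_def[abs_def] incidence_matrix_reverse)

text \<open>Vertices of \<open>v\<close> with nonnegative index suffice as targets: both halves of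
  \<open>u\<close> are approximated by prefixes of \<open>v\<close>.\<close>

lemma contracting_proj_broken_line_mem_closure:
  assumes u: "fixed_point \<sigma> u" and v: "fixed_point \<sigma> v"
  shows "contracting_proj \<sigma> (broken_line u n)
           \<in> closure (range (\<lambda>m. contracting_proj \<sigma> (broken_line v (int m))))"
proof (cases "n \<ge> 0")
  case True
  then obtain m where n: "n = int m" by (metis nonneg_int_cases)
  show ?thesis
    unfolding n broken_line_nonneg
  \<comment> \<open>A prefix of \<open>u\<close> begins all late images of \<open>u 0\<close>, so
    its vertex occurs without correction.\<close>
  proof (rule mem_closure_initial_words[OF v, where b = "u 0" and y = 0])
    have "((*v) M ^^ k) 0 = 0" for k by (induction k) (simp_all add: vec.zero)
    with eventually_initial_word[OF u, of m]
    show "eventually (\<lambda>k. \<exists>P S. (subst_word \<sigma> ^^ k) [u 0] = P @ S \<and>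
        abelianization P = abelianization (initial_word u m) + ((*v) M ^^ k) 0) sequentially"
      by (auto elim!: eventually_mono)
  qed
next
  case False
  interpret rev: unimodular_irreducible_pisot "reverse_subst \<sigma>"
    by (rule unimodular_irreducible_pisot_reverse)
  \<comment> \<open>Prefixes of \<open>w\<close> are reversed suffixes of the left half of
    \<open>u\<close>, and are governed by the prefix result for the reverse substitution.\<close>
  define w where "w = reflect u"
  define m where "m = nat (- n)"
  have "broken_line u n = - broken_line w (int m)"
    using False by (simp add: w_def broken_line_reflect m_def)
  then have *: "broken_line u n = - abelianization (initial_word w m)"
    by (simp add: broken_line_nonneg)
  show ?thesis
    unfolding * broken_line_nonneg
  \<comment> \<open>Here \<open>P\<close> is what precedes the suffix in an image of
    \<open>w 0\<close>, that is, of \<open>u (- 1)\<close>; its vertex is that of the whole image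
    minus that of the suffix, whence \<open>y\<close>.\<close>
  proof (rule mem_closure_initial_words[OF v, where b = "w 0" and y = "axis (w 0) 1"])
    have "eventually (\<lambda>k. \<exists>S. (subst_word (reverse_subst \<sigma>) ^^ k) [w 0] = initial_word w m @ S) sequentially"
      unfolding w_def by (rule rev.eventually_initial_word[OF fixed_point_reflect[OF u]])
    then show "eventually (\<lambda>k. \<exists>P S. (subst_word \<sigma> ^^ k) [w 0] = P @ S \<and>
        abelianization P = - abelianization (initial_word w m) + ((*v) M ^^ k) (axis (w 0) 1)) sequentially"
    proof eventually_elim
      case (elim k)
      then obtain S where "rev ((subst_word \<sigma> ^^ k) [w 0]) = initial_word w m @ S"
        by (auto simp: funpow_subst_word_reverse)
      then have S: "(subst_word \<sigma> ^^ k) [w 0] = rev S @ rev (initial_word w m)"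
        by (metis rev_append rev_rev_ident)
      have "abelianization ((subst_word \<sigma> ^^ k) [w 0]) = ((*v) M ^^ k) (axis (w 0) 1)"
        by (simp add: abelianization_funpow abelianization_Cons)
      then have "abelianization (rev S) = - abelianization (initial_word w m) + ((*v) M ^^ k) (axis (w 0) 1)"
        by (simp add: S algebra_simps)
      with S show ?case by blast
    qed
  qed
qed

lemma closure_broken_line:
  assumes u: "fixed_point \<sigma> u" and v: "fixed_point \<sigma> v"
  shows "closure (range (\<lambda>n. contracting_proj \<sigma> (broken_line u n)))
       = closure (range (\<lambda>n. contracting_proj \<sigma> (broken_line v n)))"
proof -
  have "closure (range (\<lambda>n. contracting_proj \<sigma> (broken_line u n)))
       \<subseteq> closure (range (\<lambda>n. contracting_proj \<sigma> (broken_line v n)))"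
    if "fixed_point \<sigma> u" "fixed_point \<sigma> v" for u v
  proof (rule closure_minimal)
    have "closure (range (\<lambda>m. contracting_proj \<sigma> (broken_line v (int m))))
        \<subseteq> closure (range (\<lambda>n. contracting_proj \<sigma> (broken_line v n)))"
      by (rule closure_mono) auto
    then show "range (\<lambda>n. contracting_proj \<sigma> (broken_line u n))
        \<subseteq> closure (range (\<lambda>n. contracting_proj \<sigma> (broken_line v n)))"
      using contracting_proj_broken_line_mem_closure[OF that] by auto
  qed simp
  with u v show ?thesis by blast
qed

lemma rauzy_fractal_eq:
  assumes "fixed_point \<sigma> u"
  shows "rauzy_fractal \<sigma> = closure (range (\<lambda>n. contracting_proj \<sigma> (broken_line u n)))"
  unfolding rauzy_fractal_def
  by (rule the_equality) (use assms closure_broken_line in blast)+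

lemma rauzy_fractal_reverse:
  assumes u: "fixed_point \<sigma> u"
  shows "rauzy_fractal (reverse_subst \<sigma>) = uminus ` rauzy_fractal \<sigma>"
proof -
  interpret rev: unimodular_irreducible_pisot "reverse_subst \<sigma>"
    by (rule unimodular_irreducible_pisot_reverse)
  have "range (\<lambda>n. contracting_proj \<sigma> (broken_line (reflect u) n))
      = uminus ` range (\<lambda>n. contracting_proj \<sigma> (broken_line u n))"
    unfolding broken_line_reflect contracting_proj_minus
  proof -
    fix g :: "int \<Rightarrow> real ^ 'k"
    have "- g n \<in> range (\<lambda>n. - g (- n))" for n
      using rangeI[of "\<lambda>n. - g (- n)" "- n"] by simp
    then show "range (\<lambda>n. - g (- n)) = uminus ` range g" by blast
  qed
  \<comment> \<open>Negation is an injective linear map, so it commutes with closure.\<close>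
  then show ?thesis
    unfolding rauzy_fractal_eq[OF u] rev.rauzy_fractal_eq[OF fixed_point_reflect[OF u]]
      contracting_proj_reverse
    by (simp only: closure_injective_linear_image[OF linear_uminus inj_uminus])
qed

end

theorem corollary2p1:
  fixes \<sigma> :: "'k::finite \<Rightarrow> 'k list"
  assumes "unimodular_subst \<sigma>"
    and "irreducible_pisot_subst \<sigma>"
    and "\<exists>u. fixed_point \<sigma> u"
  shows "rauzy_fractal \<sigma> = uminus ` rauzy_fractal (reverse_subst \<sigma>) \<and>
         uminus ` (rauzy_fractal \<sigma> \<inter> rauzy_fractal (reverse_subst \<sigma>))
           = rauzy_fractal \<sigma> \<inter> rauzy_fractal (reverse_subst \<sigma>)"
proof -
  interpret unimodular_irreducible_pisot \<sigma>
    using assms by unfold_locales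
  have eq: "rauzy_fractal (reverse_subst \<sigma>) = uminus ` rauzy_fractal \<sigma>"
    using assms(3) rauzy_fractal_reverse by blast
  \<comment> \<open>Negation is injective, so it distributes over the intersection, and as an
    involution it exchanges the two fractals.\<close>
  then show ?thesis
    by (simp add: image_Int[OF inj_uminus] image_image) blast
qed

end
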